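(* Let $F$ and $G$ be complete separable metric spaces equipped with their Borel $\sigma$-algebras $\mathcal F$ and $\mathcal G$, respectively. Let $X$ be an $F$-valued and $Y$ a $G$-valued random variable on a complete probability space $(\Omega,\Sigma,P)$. Let $\mu$ be a solution of the statistical inverse problem of estimating the distribution of $X$ given $Y$. If the family of posterior distributions $\{\mu(\cdot,y):y\in G\}$ is dominated by a Borel measure $\nu$ on $\mathcal F$ (i.e. $\mu(\cdot,y)\ll\nu$ for every $y\in G$), then for every $\epsilon>0$ there exists a compact set $K=K(\epsilon,\mu)\in\mathcal G$ such that $\mu_Y(G\setminus K)<\epsilon$ and $\mu$ is $\mathcal F_0$-continuous on $K$ for some measure-determining family $\mathcal F_0\subset\mathcal F$.
   Context: For a random variable $Z$, $\mu_Z=P\circ Z^{-1}$ is its image measure; a Borel measure and its Lebesgue completion are denoted by the same symbol. "$\mu_Y$-measurable" means measurable with respect to the completion $\mathcal G^{\mu_Y}$ of $\mathcal G$ with respect to $\mu_Y$. A solution of the statistical inverse problem of estimating the distribution of $X$ given $Y$ is a mapping $\mu:\mathcal F\times G\to[0,1]$ such that (1) $\mu(U,Y(\omega))=\mathbf E[1_U(X)\,|\,Y^{-1}(\mathcal G)](\omega)$ $P$-almost surely for every $U\in\mathcal F$; (2) $y\mapsto\mu(U,y)$ is $\mu_Y$-measurable for every $U\in\mathcal F$; (3) $U\mapsto\mu(U,y)$ is a probability measure on $(F,\mathcal F)$ for every $y\in G$. The measures $\mu(\cdot,y)$ are called posterior distributions. For $K\subset G$ and $\mathcal F_0\subset\mathcal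 F$, $\mu$ is $\mathcal F_0$-continuous on $K$ if $y\mapsto\mu(U,y)$ is continuous on $K$ with respect to the relative topology for every $U\in\mathcal F_0$. A family $\mathcal F_0\subset\mathcal F$ is measure-determining if any two probability measures on $(F,\mathcal F)$ that coincide on $\mathcal F_0$ coincide on $\mathcal F$. *)

theory Defs
  imports "HOL-Probability.Probability"
begin

text \<open>
  A map $\mathcal F \times G \to [0,1]$ that is a probability measure in its first argument is
  represented as a function \<open>\<mu>\<close> from points \<open>y\<close> to measures; the number $\mu(U,y)$ is
  \<open>measure (\<mu> y) U\<close>. The $\sigma$-algebra $Y^{-1}(\mathcal G)$ is
  \<open>vimage_algebra (space P) Y borel\<close> and the image measure $\mu_Y$ is \<open>distr P borel Y\<close>.
\<close>

definition inverse_problem_solution ::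
  "'w measure \<Rightarrow> ('w \<Rightarrow> 'f::topological_space) \<Rightarrow> ('w \<Rightarrow> 'g::topological_space)
    \<Rightarrow> ('g \<Rightarrow> 'f measure) \<Rightarrow> bool" where
  "inverse_problem_solution P X Y \<mu> \<longleftrightarrow>
     (\<forall>U\<in>sets borel. AE \<omega> in P. measure (\<mu> (Y \<omega>)) U =
        real_cond_exp P (vimage_algebra (space P) Y borel) (\<lambda>\<omega>'. indicator U (X \<omega>')) \<omega>) \<and>
     (\<forall>U\<in>sets borel. (\<lambda>y. measure (\<mu> y) U)
        \<in> borel_measurable (completion (distr P borel Y))) \<and>
     (\<forall>y. sets (\<mu> y) = sets borel \<and> prob_space (\<mu> y))"

definition family_continuous_on ::
  "'f set set \<Rightarrow> 'g::topological_space set \<Rightarrow> ('g \<Rightarrow> 'f measure) \<Rightarrow> bool" where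
  "family_continuous_on \<F>\<^sub>0 K \<mu> \<longleftrightarrow> (\<forall>U\<in>\<F>\<^sub>0. continuous_on K (\<lambda>y. measure (\<mu> y) U))"

definition measure_determining :: "'f::topological_space set set \<Rightarrow> bool" where
  "measure_determining \<F>\<^sub>0 \<longleftrightarrow>
     \<F>\<^sub>0 \<subseteq> sets borel \<and>
     (\<forall>M N. sets M = sets borel \<and> prob_space M \<and> sets N = sets borel \<and> prob_space N \<and>
        (\<forall>U\<in>\<F>\<^sub>0. measure M U = measure N U)
        \<longrightarrow> (\<forall>U\<in>sets borel. measure M U = measure N U))"

end

theory Submission
  imports Defs
begin

text \<open>
  On a Polish space the finite intersections of a countable base form a countable
  \<open>\<inter>\<close>-stable generator of the Borel sets, hence a countable measure-determining family \<open>\<F>\<^sub>0\<close>.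
  Lusin's theorem, applied simultaneously to the countably many functions \<open>y \<mapsto> \<mu>(U, y)\<close> with
  \<open>U \<in> \<F>\<^sub>0\<close>, yields the compact set \<open>K\<close>.
\<close>

text \<open>A set measurable for the completion differs from its Borel main part by a null set only,
  and finite Borel measures on Polish spaces are inner regular with respect to compact sets.\<close>

lemma inner_regular_completion:
  fixes M :: "'a::polish_space measure"
  assumes "sets M = sets borel" and "finite_measure M"
    and A: "A \<in> sets (completion M)" and "e > 0"
  obtains K where "K \<subseteq> A" "compact K" "measure (completion M) A < measure M K + e"
proof -
  interpret finite_measure M by fact
  let ?S = "main_part M A"
  have S: "?S \<in> sets M" "?S \<subseteq> A" and mS: "measure (completion M) A = measure M ?S"
    using A main_part_null_part_Un[OF A] by (auto simp: measure_def simp del: main_part_null_part_Un)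
  \<comment> \<open>\<open>ennreal\<close> truncates negative reals to 0, so the strict inequality
    below fails for a null main part; in that case the empty set serves as \<open>K\<close>.\<close>
  show ?thesis
  proof (cases "measure M ?S = 0")
    case True
    with \<open>e > 0\<close> mS that[of "{}"] show ?thesis by simp
  next
    case False
    then have pos: "0 < measure M ?S"
      by (simp add: zero_less_measure_iff)
    then have "ennreal (measure M ?S - e) < emeasure M ?S"
      using \<open>e > 0\<close> by (simp add: emeasure_eq_measure ennreal_less_iff ennreal_lessI)
    also have "\<dots> = (SUP K \<in> {K. K \<subseteq> ?S \<and> compact K}. emeasure M K)"
      using assms S by (intro inner_regular) auto
    finally obtain K where K: "K \<subseteq> ?S" "compact K" "ennreal (measure M ?S - e) < emeasure M K"
      by (auto simp: less_SUP_iff)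
    have "measure M ?S - e < measure M K"
      using K(3) ennreal_leI[of "measure M K" "measure M ?S - e"]
      unfolding emeasure_eq_measure by (meson not_le)
    then show ?thesis
      using mS by (intro that[OF subset_trans[OF K(1) S(2)] K(2)]) simp
  qed
qed

text \<open>One takes \<open>K = K1 \<union> K2\<close> with \<open>K1\<close> inside
  \<open>A\<close> and \<open>K2\<close> inside its complement, both nearly of full measure there.
  Removing the closed set \<open>K2\<close> leaves an open set whose trace on \<open>K\<close> is
  exactly that of \<open>A\<close>.\<close>

lemma compact_separating_set:
  fixes M :: "'a::polish_space measure"
  assumes sb: "sets M = sets borel" and fin: "finite_measure M"
    and A: "A \<in> sets (completion M)" and "e > 0"
  obtains K where "compact K" "measure M (UNIV - K) < e" "\<exists>C. open C \<and> C \<inter> K = A \<inter> K"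
proof -
  interpret finite_measure M by fact
  interpret C: finite_measure "completion M"
    by standard (simp add: emeasure_completion)
  have sp: "space M = UNIV"
    using sb sets_eq_imp_space_eq by fastforce
  have "UNIV - A \<in> sets (completion M)"
    using A sets.compl_sets[of A "completion M"] sp by simp
  from inner_regular_completion[OF sb fin this, of "e/2"] \<open>e > 0\<close>
  obtain K2 where K2: "K2 \<subseteq> UNIV - A" "compact K2"
      "measure (completion M) (UNIV - A) < measure M K2 + e/2" by auto
  from inner_regular_completion[OF sb fin A, of "e/2"] \<open>e > 0\<close>
  obtain K1 where K1: "K1 \<subseteq> A" "compact K1"
      "measure (completion M) A < measure M K1 + e/2" by auto
  have [measurable]: "K1 \<in> sets M" "K2 \<in> sets M"
    using K1 K2 sb by (auto intro: borel_compact)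
  \<comment> \<open>The masses of \<open>A\<close> and its complement add up to the total mass, so
    the two deficits below \<open>e/2\<close> give one below \<open>e\<close>.\<close>
  have "measure (completion M) (UNIV - A) = measure M UNIV - measure (completion M) A"
    using C.finite_measure_compl[OF A] sp sets.top[of M] by simp
  moreover have "measure M (K1 \<union> K2) = measure M K1 + measure M K2"
    using K1 K2 by (intro finite_measure_Union) auto
  moreover have "measure M (UNIV - (K1 \<union> K2)) = measure M UNIV - measure M (K1 \<union> K2)"
    using finite_measure_compl[of "K1 \<union> K2"] sp by auto
  ultimately have "measure M (UNIV - (K1 \<union> K2)) < e"
    using K1 K2 by simp
  moreover have "open (- K2)" "- K2 \<inter> (K1 \<union> K2) = A \<inter> (K1 \<union> K2)"
    using K1 K2 by (auto simp: compact_imp_closed)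
  ultimately show ?thesis
    using that[of "K1 \<union> K2"] K1(2) K2(2) by blast
qed

text \<open>Treat each set separately with geometrically decreasing error and intersect the compact
  sets. A trace that is relatively open in \<open>K n\<close> stays so on any smaller set, with the
  same witness \<open>C\<close>.\<close>

lemma compact_separating_countable_family:
  fixes M :: "'a::polish_space measure"
  assumes sb: "sets M = sets borel" and fin: "finite_measure M"
    and "countable \<A>" and \<A>: "\<A> \<subseteq> sets (completion M)" and "e > 0"
  obtains K where "compact K" "measure M (UNIV - K) < e"
    "\<And>A. A \<in> \<A> \<Longrightarrow> \<exists>C. open C \<and> C \<inter> K = A \<inter> K"
proof -
  interpret finite_measure M by fact
  \<comment> \<open>Adding the empty set makes the family nonempty, so that it is the range of a
    sequence.\<close>
  define A where "A = from_nat_into (insert {} \<A>)"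
  have rA: "range A = insert {} \<A>"
    unfolding A_def using \<open>countable \<A>\<close> by (intro range_from_nat_into) auto
  have Am: "A n \<in> sets (completion M)" for n
    using rA \<A> by (metis insert_subset rangeI sets.empty_sets subsetD)
  \<comment> \<open>These bounds sum to \<open>e/2\<close>, not \<open>e\<close>: comparing the
    series yields only \<le>, and the slack restores the strict inequality.\<close>
  have "\<exists>K. compact K \<and> measure M (UNIV - K) < e/2 * (1/2)^Suc n \<and>
      (\<exists>C. open C \<and> C \<inter> K = A n \<inter> K)" for n
  proof -
    have "e/2 * (1/2)^Suc n > 0"
      using \<open>e > 0\<close> by simp
    then show ?thesis
      by (rule compact_separating_set[OF sb fin Am[of n]]) (rule exI, intro conjI)
  qed
  then have "\<exists>K. \<forall>n. compact (K n) \<and> measure M (UNIV - K n) < e/2 * (1/2)^Suc n \<and>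
      (\<exists>C. open C \<and> C \<inter> K n = A n \<inter> K n)"
    by (intro choice allI)
  then obtain K where K: "\<And>n. compact (K n)"
      "\<And>n. measure M (UNIV - K n) < e/2 * (1/2)^Suc n"
      "\<And>n. \<exists>C. open C \<and> C \<inter> K n = A n \<inter> K n"
    by auto
  have sums: "(\<lambda>n. e/2 * (1/2)^Suc n) sums (e/2)"
    using sums_mult[OF power_half_series, of "e/2"] by simp
  have summ: "summable (\<lambda>n. measure M (UNIV - K n))"
    by (rule summable_comparison_test'[OF sums_summable[OF sums]])
      (use K(2) in \<open>auto intro: less_imp_le\<close>)
  have meas: "UNIV - K n \<in> sets M" for n
    using K(1) sb by (auto intro!: borel_open simp: open_Diff compact_imp_closed)
  have "measure M (UNIV - (\<Inter>n. K n)) = measure M (\<Union>n. UNIV - K n)"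
    by (rule arg_cong[where f="measure M"]) auto
  also have "\<dots> \<le> (\<Sum>n. measure M (UNIV - K n))"
    using meas summ by (intro finite_measure_subadditive_countably) auto
  also have "\<dots> \<le> (\<Sum>n. e/2 * (1/2)^Suc n)"
    using K(2) summ sums_summable[OF sums] by (intro suminf_le) (auto intro: less_imp_le)
  also have "\<dots> < e"
    using sums_unique[OF sums] \<open>e > 0\<close> by simp
  finally have "measure M (UNIV - (\<Inter>n. K n)) < e" .
  moreover have "closed (\<Inter>n. K n)"
    by (rule closed_INT) (use K(1) compact_imp_closed in blast)
  \<comment> \<open>The intersection is a closed subset of the compact set
    \<open>K 0\<close>.\<close>
  then have "compact (\<Inter>n. K n)"
    using compact_Int_closed[OF K(1)[of 0]] Int_absorb1[OF INT_lower[OF UNIV_I, of K 0]] by metis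
  moreover have "\<exists>C. open C \<and> C \<inter> (\<Inter>n. K n) = B \<inter> (\<Inter>n. K n)" if "B \<in> \<A>" for B
  proof -
    have "B \<in> range A"
      unfolding rA using that by simp
    then obtain n where "B = A n" ..
    moreover obtain C where "open C" "C \<inter> K n = A n \<inter> K n"
      using K(3) by auto
    moreover have "K n \<inter> (\<Inter>n. K n) = (\<Inter>n. K n)"
      by auto
    ultimately have "C \<inter> (\<Inter>n. K n) = B \<inter> (\<Inter>n. K n)"
      by (metis Int_assoc)
    with \<open>open C\<close> show ?thesis by auto
  qed
  ultimately show ?thesis by (intro that)
qed

text \<open>Continuity on \<open>K\<close> need only be tested on a countable subbasis of the
  codomain. The preimages of its members under all \<open>f i\<close> form a countable family, so a
  single \<open>K\<close> makes all of them relatively open.\<close>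

lemma Lusin_countable_family:
  fixes M :: "'a::polish_space measure" and f :: "'i \<Rightarrow> 'a \<Rightarrow> 'b::second_countable_topology"
  assumes sb: "sets M = sets borel" and fin: "finite_measure M"
    and "countable I" and f: "\<And>i. i \<in> I \<Longrightarrow> f i \<in> borel_measurable (completion M)"
    and "e > 0"
  obtains K where "compact K" "measure M (UNIV - K) < e" "\<And>i. i \<in> I \<Longrightarrow> continuous_on K (f i)"
proof -
  obtain B :: "'b set set" where B: "countable B" "open = generate_topology B"
    using ex_countable_subbasis by blast
  have sp: "space M = UNIV"
    using sb sets_eq_imp_space_eq by fastforce
  have oB: "open V" if "V \<in> B" for V
    using generate_topology.Basis[OF that] by (simp only: B(2))
  let ?A = "(\<lambda>(i, V). f i -` V) ` (I \<times> B)"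
  have "countable ?A"
    using \<open>countable I\<close> B(1) by auto
  moreover have "f i -` V \<in> sets (completion M)" if "i \<in> I" "V \<in> B" for i V
    using measurable_sets[OF f[OF that(1)] borel_open[OF oB[OF that(2)]]] sp by simp
  then have "?A \<subseteq> sets (completion M)"
    by auto
  ultimately obtain K where K: "compact K" "measure M (UNIV - K) < e"
      "\<And>A. A \<in> ?A \<Longrightarrow> \<exists>C. open C \<and> C \<inter> K = A \<inter> K"
    using compact_separating_countable_family[OF sb fin _ _ \<open>e > 0\<close>, of ?A] by blast
  have "continuous_on K (f i)" if "i \<in> I" for i
    using that by (intro continuous_on_generate_topology[OF B(2)] K(3)) auto
  with K that show ?thesis by blast
qed

text \<open>By Dynkin's argument, probability measures agreeing on an intersection-stable generator
  coincide. Countability is what lets Lusin's theorem treat all members at once.\<close>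

lemma countable_measure_determining:
  obtains \<F> :: "'f::second_countable_topology set set"
  where "countable \<F>" "measure_determining \<F>"
proof -
  obtain B :: "'f set set" where B: "countable B" "topological_basis B"
    using ex_countable_basis by blast
  define E where "E = Inter ` {F. finite F \<and> F \<subseteq> B}"
  have "countable E"
    unfolding E_def using B(1) by (intro countable_image countable_Collect_finite_subset)
  have oE: "open U" if "U \<in> E" for U
    using that topological_basis_open[OF B(2)] by (auto simp: E_def intro!: open_Inter)
  have "B \<subseteq> E"
  proof
    fix U assume "U \<in> B"
    then show "U \<in> E"
      unfolding E_def by (intro image_eqI[of _ _ "{U}"]) auto
  qed
  have stable: "Int_stable E"
  proof (rule Int_stableI)
    fix U V assume "U \<in> E" "V \<in> E"
    then obtain F F' where "finite F" "F \<subseteq> B" "U = \<Inter>F" "finite F'" "F' \<subseteq> B" "V = \<Inter>F'"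
      by (auto simp: E_def)
    then show "U \<inter> V \<in> E"
      unfolding E_def by (intro image_eqI[of _ _ "F \<union> F'"]) auto
  qed
  \<comment> \<open>\<open>E\<close> lies between the base \<open>B\<close>, which generates the
    Borel sets by countability, and the open sets.\<close>
  have gen: "sets borel = sigma_sets UNIV E"
  proof
    have "sets borel = sigma_sets UNIV B"
      by (simp add: borel_eq_countable_basis[OF B])
    then show "sets borel \<subseteq> sigma_sets UNIV E"
      using sigma_sets_mono'[OF \<open>B \<subseteq> E\<close>, of UNIV] by simp
    have "E \<subseteq> sets borel"
      using oE by (simp add: subsetI)
    then show "sigma_sets UNIV E \<subseteq> sets borel"
      using sets.sigma_sets_subset[of E "borel :: 'f measure"] by simp
  qed
  \<comment> \<open>The empty intersection gives the whole space, so the constant sequence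
    \<open>UNIV\<close> is the exhaustion by sets of finite measure that the uniqueness theorem asks
    for.\<close>
  have top: "UNIV \<in> E"
    unfolding E_def by (intro image_eqI[of _ _ "{}"]) auto
  have "M = N" if "sets M = sets borel" "prob_space M" "sets N = sets borel" "prob_space N"
    and eq: "\<forall>U\<in>E. measure M U = measure N U" for M N :: "'f measure"
  proof -
    interpret M: prob_space M by fact
    interpret N: prob_space N by fact
    show ?thesis
      using that gen top
      by (intro measure_eqI_generator_eq[OF stable, of UNIV M N "\<lambda>_. UNIV"])
        (auto simp: M.emeasure_eq_measure N.emeasure_eq_measure)
  qed
  moreover have "E \<subseteq> sets borel"
    using oE by (simp add: subsetI)
  ultimately have "measure_determining E"
    unfolding measure_determining_def by (intro conjI allI impI) (assumption, metis)
  with \<open>countable E\<close> show ?thesis by (rule that)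
qed

theorem theorem2p9:
  fixes P :: "'w measure"
    and X :: "'w \<Rightarrow> 'f::polish_space"
    and Y :: "'w \<Rightarrow> 'g::polish_space"
    and \<mu> :: "'g \<Rightarrow> 'f measure"
    and \<nu> :: "'f measure"
    and \<epsilon> :: real
  assumes "prob_space P" and "complete_measure P"
    and "X \<in> measurable P borel" and "Y \<in> measurable P borel"
    and "inverse_problem_solution P X Y \<mu>"
    and "sets \<nu> = sets borel"
    and "\<And>y. absolutely_continuous \<nu> (\<mu> y)"
    and "\<epsilon> > 0"
  shows "\<exists>K. compact K \<and> K \<in> sets borel \<and>
           measure (distr P borel Y) (UNIV - K) < \<epsilon> \<and>
           (\<exists>\<F>\<^sub>0. measure_determining \<F>\<^sub>0 \<and> family_continuous_on \<F>\<^sub>0 K \<mu>)"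
proof -
  interpret prob_space P by fact
  interpret D: prob_space "distr P borel Y"
    using assms(4) by (rule prob_space_distr)
  obtain \<F>\<^sub>0 :: "'f set set" where F: "countable \<F>\<^sub>0" "measure_determining \<F>\<^sub>0"
    by (rule countable_measure_determining)
  \<comment> \<open>Condition (2) on a solution gives measurability for the completion of the law of
    \<open>Y\<close> only, which is why Lusin's theorem was stated for completions.\<close>
  have "(\<lambda>y. measure (\<mu> y) U) \<in> borel_measurable (completion (distr P borel Y))"
    if "U \<in> \<F>\<^sub>0" for U
    using that F(2) assms(5) unfolding inverse_problem_solution_def measure_determining_def by blast
  \<comment> \<open>The functions are indexed by the sets of \<open>\<F>\<^sub>0\<close> themselves,
    so \<open>K\<close> does not depend on \<open>U\<close>.\<close>
  then obtain K where "compact K" "measure (distr P borel Y) (UNIV - K) < \<epsilon>"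
      "\<And>U. U \<in> \<F>\<^sub>0 \<Longrightarrow> continuous_on K (\<lambda>y. measure (\<mu> y) U)"
    using Lusin_countable_family[of "distr P borel Y" \<F>\<^sub>0 "\<lambda>U y. measure (\<mu> y) U"]
      F(1) D.finite_measure_axioms \<open>\<epsilon> > 0\<close> by auto
  with F(2) show ?thesis
    unfolding family_continuous_on_def by (auto intro!: exI[of _ K] borel_compact)
qed

end
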